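(* For each $n\geq 2$ let $t_n$ be any integer in $\{2,\ldots,n\}$ minimizing $F_n(x)=x^{2}+r(a+1)^{2}+(x-1-r)a^{2}$ over feasible $x\in\{2,\ldots,n\}$, where $n-x=a(x-1)+r$ with $a\in\mathbb{N}_0$, $0\leq r<x-1$, and $x$ is feasible if $x\geq a$ when $r=0$ and $x\geq a+1$ when $r\neq0$. Then $t_n=\Theta(n^{2/3})$, i.e., there are constants $0<c\leq C$ and $N$ such that $c\,n^{2/3}\leq t_n\leq C\,n^{2/3}$ for all $n\geq N$.
   Context: $\mathbb{N}_0$ is the set of nonnegative integers. *)

theory Defs
  imports Complex_Main "HOL-Library.Landau_Symbols"
begin

text \<open>
  For \<open>2 \<le> x \<le> n\<close> the decomposition \<open>n - x = a * (x - 1) + r\<close> with \<open>0 \<le> r < x - 1\<close> is division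
  with remainder by \<open>x - 1 \<ge> 1\<close>. In that range no natural-number subtraction below truncates.
\<close>

definition quot_a :: "nat \<Rightarrow> nat \<Rightarrow> nat" where
  "quot_a n x = (n - x) div (x - 1)"

definition rem_r :: "nat \<Rightarrow> nat \<Rightarrow> nat" where
  "rem_r n x = (n - x) mod (x - 1)"

lemma quot_a_rem_r_unique:
  fixes n x a r :: nat
  assumes "2 \<le> x" "x \<le> n"
  shows "n - x = a * (x - 1) + r \<and> r < x - 1 \<longleftrightarrow> a = quot_a n x \<and> r = rem_r n x"
  using assms div_mult_mod_eq[of "n - x" "x - 1"]
  by (auto simp: quot_a_def rem_r_def simp del: div_mult_mod_eq)

definition feasible :: "nat \<Rightarrow> nat \<Rightarrow> bool" where
  "feasible n x \<longleftrightarrow>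
     x \<in> {2..n} \<and>
     (rem_r n x = 0 \<longrightarrow> x \<ge> quot_a n x) \<and>
     (rem_r n x \<noteq> 0 \<longrightarrow> x \<ge> quot_a n x + 1)"

definition F :: "nat \<Rightarrow> nat \<Rightarrow> nat" where
  "F n x = x ^ 2 + rem_r n x * (quot_a n x + 1) ^ 2 + (x - 1 - rem_r n x) * quot_a n x ^ 2"

end

theory Submission
  imports Defs
begin

text \<open>
  Put \<open>k = x - 1\<close> and \<open>m = n - x\<close>. The last two summands of \<open>F n x\<close> are the sum of squares of \<open>k\<close>
  integers with total \<open>m\<close> that are as equal as possible, so their value
  lies between \<open>m\<^sup>2 / k\<close> (Cauchy--Schwarz) and \<open>(m / k + 1) m\<close>. Hence \<open>F n x\<close> behaves like \<open>x\<^sup>2 + n\<^sup>2 / x\<close>. With \<open>L = n\<^bsup>2/3\<^esup>\<close>, the feasible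
  point \<open>\<lceil>L\<rceil> + 1\<close> shows that the minimum is at most \<open>11 L\<^sup>2\<close>; comparing with \<open>x\<^sup>2 \<le> F n x\<close> bounds
  the minimizer from above, and comparing with the Cauchy--Schwarz bound, where \<open>m \<ge> n / 2\<close> and
  \<open>n\<^sup>2 = L\<^sup>3\<close>, bounds it from below.
\<close>

lemma quot_a_mult_add_rem_r: "quot_a n x * (x - 1) + rem_r n x = n - x"
  unfolding quot_a_def rem_r_def by (rule div_mult_mod_eq)

lemma rem_r_less: "2 \<le> x \<Longrightarrow> rem_r n x < x - 1"
  by (simp add: rem_r_def)

lemma square_le_F: "x\<^sup>2 \<le> F n x"
  by (simp add: F_def)

text \<open>Over the reals the truncated subtraction in \<open>F\<close> disappears, leaving a
  polynomial in the quotient and remainder.\<close>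

lemma real_F_expand:
  assumes "2 \<le> x" "x \<le> n"
  shows "real (F n x) = (real x)\<^sup>2 + (real x - 1) * (real (quot_a n x))\<^sup>2
           + 2 * real (rem_r n x) * real (quot_a n x) + real (rem_r n x)"
proof -
  have "real (x - 1 - rem_r n x) = real x - 1 - real (rem_r n x)"
    using rem_r_less[OF assms(1), of n] assms by (simp add: of_nat_diff)
  then show ?thesis
    unfolding F_def of_nat_add of_nat_mult of_nat_power
    by (simp add: algebra_simps power2_eq_square)
qed

lemma real_quot_rem:
  assumes "2 \<le> x" "x \<le> n"
  shows "real n - real x = real (quot_a n x) * (real x - 1) + real (rem_r n x)"
proof -
  have "real (n - x) = real (quot_a n x * (x - 1) + rem_r n x)"
    by (simp only: quot_a_mult_add_rem_r)
  then show ?thesis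
    using assms by (simp add: of_nat_diff)
qed

text \<open>With \<open>k = x - 1\<close>, the right side minus the left is exactly
  \<open>k * x^2 + r * (k - r)\<close>, and \<open>r\<close> lies between 0 and
  \<open>k\<close>.\<close>

lemma F_cauchy_schwarz:
  assumes "2 \<le> x" "x \<le> n"
  shows "(real n - real x)\<^sup>2 \<le> (real x - 1) * real (F n x)"
proof -
  define k a r where "k = real x - 1" and "a = real (quot_a n x)" and "r = real (rem_r n x)"
  have r: "0 \<le> r" "r \<le> k"
    using rem_r_less[OF assms(1), of n] assms by (auto simp: r_def k_def)
  have "k * real (F n x) - (real n - real x)\<^sup>2 = k * (real x)\<^sup>2 + r * (k - r)"
    unfolding real_F_expand[OF assms] real_quot_rem[OF assms]
    unfolding k_def[symmetric] a_def[symmetric] r_def[symmetric]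
    by (simp add: algebra_simps power2_eq_square)
  moreover have "0 \<le> k * (real x)\<^sup>2" "0 \<le> r * (k - r)"
    using r by auto
  ultimately show ?thesis
    by (simp add: k_def)
qed

text \<open>The sum of squares equals \<open>(a + 1) * (a * k + r) - a * (k - r)\<close>, and the
  subtracted term is nonnegative.\<close>

lemma F_upper_bound:
  assumes "2 \<le> x" "x \<le> n"
  shows "real (F n x) \<le> (real x)\<^sup>2 + (real n / (real x - 1) + 1) * real n"
proof -
  define k a r where "k = real x - 1" and "a = real (quot_a n x)" and "r = real (rem_r n x)"
  have k: "0 < k" and r: "0 \<le> r" "r \<le> k" and a: "0 \<le> a"
    using rem_r_less[OF assms(1), of n] assms by (auto simp: r_def k_def a_def)
  have m: "real n - real x = a * k + r"
    using real_quot_rem[OF assms] by (simp add: k_def a_def r_def)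
  then have "a * k \<le> real n"
    using r by linarith
  then have an: "a \<le> real n / k"
    using k by (simp add: field_simps)
  have "0 \<le> a * (k - r)"
    using a r by simp
  then have "real (F n x) \<le> (real x)\<^sup>2 + (a + 1) * (a * k + r)"
    unfolding real_F_expand[OF assms]
    unfolding k_def[symmetric] a_def[symmetric] r_def[symmetric]
    by (simp add: algebra_simps power2_eq_square)
  also have "\<dots> \<le> (real x)\<^sup>2 + (real n / k + 1) * real n"
    unfolding m[symmetric] using an a assms by (intro add_left_mono mult_mono) auto
  finally show ?thesis
    by (simp add: k_def)
qed

text \<open>The strict inequality forces the quotient below \<open>x\<close>, which settles both
  remainder cases at once.\<close>

lemma feasibleI:
  assumes "2 \<le> x" "x \<le> n" "n < x * (x - 1)"
  shows "feasible n x"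
proof -
  have "quot_a n x < x"
    using assms by (auto simp: quot_a_def less_mult_imp_div_less)
  then show ?thesis
    using assms by (simp add: feasible_def)
qed

text \<open>Cubing turns comparisons with \<open>n powr (2/3)\<close> into comparisons of integer
  powers of \<open>n\<close>.\<close>

lemma cube_le_imp_le:
  fixes x y :: real
  assumes "x ^ 3 \<le> y ^ 3" "0 \<le> y"
  shows "x \<le> y"
  using power_le_imp_le_base[of x 2 y] assms by (simp add: numeral_3_eq_3)

lemma arg_min_F_bounds:
  assumes n: "512 \<le> n" and t: "is_arg_min (F n) (feasible n) t"
  defines "L \<equiv> real n powr (2/3)"
  shows "L / 44 \<le> real t" "real t \<le> 4 * L"
proof -
  have L3: "L ^ 3 = (real n)\<^sup>2"
    using n by (simp add: L_def powr_power)
  have L1: "1 \<le> L"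
    unfolding L_def using n by (intro ge_one_powr_ge_zero) auto
  \<comment> \<open>The threshold is \<open>512 = 8 ^ 3\<close>. This bound later yields both
    \<open>w \<le> n\<close> and \<open>t \<le> n / 2\<close>.\<close>
  have n8: "8 * L \<le> real n"
  proof (rule cube_le_imp_le)
    have "512 * (real n)\<^sup>2 \<le> real n * (real n)\<^sup>2"
      using n by (intro mult_right_mono) auto
    then show "(8 * L) ^ 3 \<le> real n ^ 3"
      by (simp add: power_mult_distrib L3 flip: power_Suc)
  qed simp
  have nL: "real n \<le> L\<^sup>2"
  proof (rule cube_le_imp_le)
    have "(L\<^sup>2) ^ 3 = (L ^ 3)\<^sup>2"
      by (simp flip: power_mult)
    also have "\<dots> = real n ^ 4"
      by (simp add: L3 flip: power_mult)
    finally show "real n ^ 3 \<le> (L\<^sup>2) ^ 3"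
      using n by (simp add: power_increasing)
  qed simp

  \<comment> \<open>The added 1 gives \<open>w - 1 \<ge> L\<close>, hence
    \<open>w * (w - 1) > L^2 \<ge> n\<close> and \<open>n / (w - 1) \<le> n / L\<close>.\<close>
  define w where "w = nat \<lceil>L\<rceil> + 1"
  have w: "L + 1 \<le> real w" "real w \<le> L + 2"
    using L1 unfolding w_def by linarith+
  have w2: "2 \<le> w" and wn: "w \<le> n"
    using w L1 n8 by linarith+
  have "L * L < real w * (real w - 1)"
    using w L1 by (intro mult_less_le_imp_less) auto
  then have "real n < real (w * (w - 1))"
    using nL w2 by (simp add: of_nat_diff power2_eq_square)
  then have "n < w * (w - 1)"
    by linarith
  then have "feasible n w"
    using w2 wn by (intro feasibleI)
  then have "F n t \<le> F n w" and "feasible n t"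
    using t by (auto simp: is_arg_min_def not_less)
  then have t2: "2 \<le> t" and tn: "t \<le> n"
    by (auto simp: feasible_def)

  have "real n / (real w - 1) \<le> real n / L"
    using w L1 by (intro divide_left_mono) auto
  then have "(real n / (real w - 1) + 1) * real n \<le> (real n / L + 1) * real n"
    by (intro mult_right_mono) auto
  also have "\<dots> = L\<^sup>2 + real n"
  proof -
    have "real n * real n / L = L\<^sup>2"
      using L1 L3 by (simp add: field_simps power2_eq_square power3_eq_cube)
    then show ?thesis
      by (simp add: field_simps)
  qed
  also have "\<dots> \<le> 2 * L\<^sup>2"
    using nL by simp
  finally have "(real n / (real w - 1) + 1) * real n \<le> 2 * L\<^sup>2" .
  \<comment> \<open>Here \<open>w \<le> L + 2 \<le> 3 * L\<close>; the constant 11 below is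
    \<open>9 + 2\<close>.\<close>
  moreover have "(real w)\<^sup>2 \<le> (3 * L)\<^sup>2"
    using w L1 by (intro power_mono) auto
  ultimately have "real (F n w) \<le> 11 * L\<^sup>2"
    using F_upper_bound[OF w2 wn] by (simp add: power_mult_distrib)
  then have F11: "real (F n t) \<le> 11 * L\<^sup>2"
    using \<open>F n t \<le> F n w\<close> by linarith

  have "(real t)\<^sup>2 \<le> real (F n t)"
    using square_le_F[of t n] by (simp flip: of_nat_power)
  \<comment> \<open>4 is the least integer whose square is at least 11.\<close>
  also have "\<dots> \<le> (4 * L)\<^sup>2"
    using F11 zero_le_power2[of L] by (simp add: power_mult_distrib)
  finally show t4: "real t \<le> 4 * L"
    by (rule power2_le_imp_le) (use L1 in simp)

  \<comment> \<open>The upper bound just proved gives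
    \<open>t \<le> 4 * L \<le> n / 2\<close>.\<close>
  have "(real n / 2)\<^sup>2 \<le> (real n - real t)\<^sup>2"
    using t4 n8 by (intro power_mono) auto
  also have "\<dots> \<le> (real t - 1) * real (F n t)"
    by (rule F_cauchy_schwarz[OF t2 tn])
  also have "\<dots> \<le> real t * (11 * L\<^sup>2)"
    using F11 t2 by (intro mult_mono) auto
  \<comment> \<open>Substituting \<open>n^2 = L^3\<close> and clearing the factor 1/4 gives
    \<open>44 = 4 * 11\<close>; then \<open>L^2\<close> cancels.\<close>
  finally have "L * L\<^sup>2 \<le> (44 * real t) * L\<^sup>2"
    using L3 by (simp add: power_divide power3_eq_cube power2_eq_square field_simps)
  then have "L \<le> 44 * real t"
    by (rule mult_right_le_imp_le) (use L1 in simp)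
  then show "L / 44 \<le> real t"
    by simp
qed

theorem theorem7:
  fixes t :: "nat \<Rightarrow> nat"
  assumes "\<And>n. n \<ge> 2 \<Longrightarrow> is_arg_min (F n) (feasible n) (t n)"
  shows "(\<lambda>n. real (t n)) \<in> \<Theta>(\<lambda>n. real n powr (2/3)) \<and>
         (\<exists>c C :: real. \<exists>N :: nat. 0 < c \<and> c \<le> C \<and>
            (\<forall>n\<ge>N. c * real n powr (2/3) \<le> real (t n) \<and>
                   real (t n) \<le> C * real n powr (2/3)))"
proof -
  have bounds: "1/44 * real n powr (2/3) \<le> real (t n) \<and> real (t n) \<le> 4 * real n powr (2/3)"
    if "512 \<le> n" for n
    using arg_min_F_bounds[OF that assms] that by simp
  have "(\<lambda>n. real (t n)) \<in> \<Theta>(\<lambda>n. real n powr (2/3))"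
  proof (rule bigthetaI')
    show "\<forall>\<^sub>F n in sequentially.
        1/44 * norm (real n powr (2/3)) \<le> norm (real (t n)) \<and>
        norm (real (t n)) \<le> 4 * norm (real n powr (2/3))"
      using eventually_ge_at_top[of 512] by eventually_elim (use bounds in simp)
  qed auto
  moreover have "\<exists>c C :: real. \<exists>N :: nat. 0 < c \<and> c \<le> C \<and>
      (\<forall>n\<ge>N. c * real n powr (2/3) \<le> real (t n) \<and> real (t n) \<le> C * real n powr (2/3))"
    by (rule exI[of _ "1/44"], rule exI[of _ 4], rule exI[of _ 512]) (use bounds in auto)
  ultimately show ?thesis ..
qed

end
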